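(* Let $n,k,d$ be non-negative integers with $n\geq 2$, and let $G$ be an $(n,k,d)$-graph. Then for an edge $uv\in E(G)$, the graph $G-uv$ is not an $(n-2,k,d)$-graph if and only if there exists a vertex subset $S\subseteq V(G)$ with $|S|=n-2+2k$ such that $G[S]$ contains a $k$-matching and $G-S$ is the disjoint union of $d$ odd components, each of which is factor-critical, together with one further component consisting of the single edge $uv$ (i.e., the subgraph on $\{u,v\}$ with edge $uv$).
   Context: All graphs are finite, undirected and simple. $G[S]$ is the subgraph induced by $S$ and $G-S$ is the subgraph induced by $V(G)\setminus S$. A $k$-matching is a matching with exactly $k$ edges. For a non-negative integer $d$, a defect-$d$ matching of a graph $H$ is a matching covering exactly $|V(H)|-d$ vertices of $H$. A matching $M$ extends to a matching $M'$ if $M\subseteq M'$. A graph is factor-critical if deleting any one of its vertices leaves a graph with a perfect matching (a single vertex is factor-critical). Let $n,k,d$ be non-negative integers. A graph $G$ is an $(n,k,d)$-graph if $|V(G)|\geq n+2k+d+2$, $|V(G)|-n-d$ is even, and for every set $S$ of $n$ vertices of $G$, the graph $H=G-S$ contains a $k$-matching and every $k$-matching of $H$ can be extended to a defect-$d$ matching of $H$. *)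

theory Defs
  imports Main
begin

text \<open>A graph is given by its vertex set and its edge set; edges are two-element sets of vertices.\<close>

type_synonym 'a ugraph = "'a set \<times> 'a set set"

abbreviation verts :: "'a ugraph \<Rightarrow> 'a set" where
  "verts G \<equiv> fst G"

abbreviation edges :: "'a ugraph \<Rightarrow> 'a set set" where
  "edges G \<equiv> snd G"

definition simple_graph :: "'a ugraph \<Rightarrow> bool" where
  "simple_graph G \<longleftrightarrow> finite (verts G) \<and> (\<forall>e\<in>edges G. e \<subseteq> verts G \<and> card e = 2)"

definition induced :: "'a ugraph \<Rightarrow> 'a set \<Rightarrow> 'a ugraph" where
  "induced G S = (verts G \<inter> S, {e \<in> edges G. e \<subseteq> S})"

definition delete_verts :: "'a ugraph \<Rightarrow> 'a set \<Rightarrow> 'a ugraph" where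
  "delete_verts G S = induced G (verts G - S)"

definition delete_edge :: "'a ugraph \<Rightarrow> 'a set \<Rightarrow> 'a ugraph" where
  "delete_edge G e = (verts G, edges G - {e})"

definition matching :: "'a ugraph \<Rightarrow> 'a set set \<Rightarrow> bool" where
  "matching G M \<longleftrightarrow> M \<subseteq> edges G \<and> pairwise disjnt M"

definition k_matching :: "nat \<Rightarrow> 'a ugraph \<Rightarrow> 'a set set \<Rightarrow> bool" where
  "k_matching k G M \<longleftrightarrow> matching G M \<and> card M = k"

text \<open>Covering exactly \<open>|V(G)| - d\<close> vertices is written additively, which avoids truncated
  subtraction when \<open>d\<close> exceeds \<open>|V(G)|\<close>.\<close>

definition defect_matching :: "nat \<Rightarrow> 'a ugraph \<Rightarrow> 'a set set \<Rightarrow> bool" where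
  "defect_matching d G M \<longleftrightarrow> matching G M \<and> card (\<Union>M) + d = card (verts G)"

definition perfect_matching :: "'a ugraph \<Rightarrow> 'a set set \<Rightarrow> bool" where
  "perfect_matching G M \<longleftrightarrow> matching G M \<and> \<Union>M = verts G"

definition factor_critical :: "'a ugraph \<Rightarrow> bool" where
  "factor_critical G \<longleftrightarrow> (\<forall>v\<in>verts G. \<exists>M. perfect_matching (delete_verts G {v}) M)"

definition adjacency :: "'a ugraph \<Rightarrow> 'a rel" where
  "adjacency G = {(x, y). {x, y} \<in> edges G}"

text \<open>The components are subgraphs, not merely vertex sets: those induced by the sets
  of vertices reachable from a given vertex.\<close>

definition components :: "'a ugraph \<Rightarrow> 'a ugraph set" where
  "components G = (\<lambda>v. induced G ((adjacency G)\<^sup>* `` {v})) ` verts G"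

definition nkd_graph :: "nat \<Rightarrow> nat \<Rightarrow> nat \<Rightarrow> 'a ugraph \<Rightarrow> bool" where
  "nkd_graph n k d G \<longleftrightarrow>
     card (verts G) \<ge> n + 2 * k + d + 2 \<and>
     even (card (verts G) - n - d) \<and>
     (\<forall>S. S \<subseteq> verts G \<and> card S = n \<longrightarrow>
        (\<exists>M. k_matching k (delete_verts G S) M) \<and>
        (\<forall>M. k_matching k (delete_verts G S) M \<longrightarrow>
           (\<exists>M'. M \<subseteq> M' \<and> defect_matching d (delete_verts G S) M')))"

end

theory Submission imports Defs begin

text \<open>For the forward direction, let \<open>M\<close> be a \<open>k\<close>-matching of \<open>G - uv\<close> avoiding a set \<open>T\<close> of \<open>n - 2\<close>
  vertices that has no defect-\<open>d\<close> extension, put \<open>S = T \<union> V(M)\<close> and \<open>H = G - uv - S\<close>. Deleting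
  two further vertices \<open>x\<close>, \<open>y\<close> and using that \<open>G\<close> is an \<open>(n,k,d)\<close>-graph gives a matching of \<open>G - S\<close>
  that misses \<open>x\<close>, \<open>y\<close> and \<open>d\<close> more vertices. Taking \<open>x\<close> to be \<open>u\<close> or \<open>v\<close>, this is a matching of \<open>H\<close>
  of defect \<open>d + 2\<close>, which is optimal by parity. Hence in \<open>H\<close> every vertex is missed by some
  maximum matching, and Gallai's lemma says that each maximum matching misses exactly one vertex of
  each component: there are \<open>d + 2\<close> components, all factor-critical, and \<open>u\<close>, \<open>v\<close> are isolated as
  each of them is missed together with any other vertex. The converse is a parity count.\<close>

section \<open>Matchings and components\<close>

lemma verts_delete_verts [simp]: "verts (delete_verts G S) = verts G - S"
  by (auto simp: delete_verts_def induced_def)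

lemma edges_delete_verts: "edges (delete_verts G S) = {e \<in> edges G. e \<subseteq> verts G - S}"
  by (auto simp: delete_verts_def induced_def)

lemma verts_delete_edge [simp]: "verts (delete_edge G e) = verts G"
  by (simp add: delete_edge_def)

lemma edges_delete_edge [simp]: "edges (delete_edge G e) = edges G - {e}"
  by (simp add: delete_edge_def)

lemma simple_graph_delete_verts: "simple_graph G \<Longrightarrow> simple_graph (delete_verts G S)"
  by (auto simp: simple_graph_def edges_delete_verts)

lemma simple_graph_delete_edge: "simple_graph G \<Longrightarrow> simple_graph (delete_edge G e)"
  by (auto simp: simple_graph_def)

lemma delete_verts_delete_edge:
  "delete_verts (delete_edge G e) S = delete_edge (delete_verts G S) e"
  by (auto simp: delete_verts_def induced_def delete_edge_def)

lemma matching_delete_verts: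
  assumes "simple_graph G"
  shows "matching (delete_verts G S) M \<longleftrightarrow> matching G M \<and> \<Union>M \<inter> S = {}"
  using assms unfolding matching_def edges_delete_verts simple_graph_def by blast

lemma matching_delete_edge: "matching (delete_edge G e) M \<longleftrightarrow> matching G M \<and> e \<notin> M"
  by (auto simp: matching_def)

lemma matching_subset: "matching G M \<Longrightarrow> N \<subseteq> M \<Longrightarrow> matching G N"
  unfolding matching_def by (meson pairwise_subset subset_trans)

lemma matching_Union_subset: "simple_graph G \<Longrightarrow> matching G M \<Longrightarrow> \<Union>M \<subseteq> verts G"
  unfolding matching_def simple_graph_def by blast

lemma finite_matching:
  assumes "simple_graph G" "matching G M"
  shows "finite M" "finite (\<Union>M)"
proof -
  show "finite (\<Union>M)"
    using matching_Union_subset[OF assms] assms(1) by (auto simp: simple_graph_def intro: finite_subset)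
  then show "finite M" by (rule finite_UnionD)
qed

lemma card_Union_matching:
  assumes "simple_graph G" "matching G M"
  shows "card (\<Union>M) = 2 * card M"
proof -
  have two: "card e = 2" if "e \<in> M" for e
    using assms that by (auto simp: matching_def simple_graph_def)
  have "card (\<Union>M) = sum card M"
    using assms two by (intro card_Union_disjoint) (auto simp: matching_def intro: card_ge_0_finite)
  also have "\<dots> = 2 * card M" using two by simp
  finally show ?thesis .
qed

lemma matching_insert:
  "matching G (insert e M) \<longleftrightarrow> e \<in> edges G \<and> matching G M \<and> (\<forall>f\<in>M. f \<noteq> e \<longrightarrow> e \<inter> f = {})"
  by (auto simp: matching_def pairwise_insert disjnt_def)

lemma matching_edges_disjoint:
  "matching G M \<Longrightarrow> e \<in> M \<Longrightarrow> f \<in> M \<Longrightarrow> e \<noteq> f \<Longrightarrow> e \<inter> f = {}"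
  unfolding matching_def pairwise_def disjnt_def by blast

lemma matching_Un:
  assumes "matching G M" "matching G N" "\<Union>M \<inter> \<Union>N = {}"
  shows "matching G (M \<union> N)"
proof -
  have MN: "e \<inter> f = {}" if "e \<in> M" "f \<in> N" for e f
    using assms(3) that by blast
  have "disjnt e f" if "e \<in> M \<union> N" "f \<in> M \<union> N" "e \<noteq> f" for e f
    using that MN[of e f] MN[of f e] matching_edges_disjoint[OF assms(1), of e f]
      matching_edges_disjoint[OF assms(2), of e f]
    by (auto simp: disjnt_def)
  then show ?thesis using assms(1,2) by (auto simp: matching_def pairwise_def)
qed

text \<open>Distinct edges of a matching share no vertex, so discarding \<open>N\<close> frees
  exactly the vertices of \<open>N\<close>. This is used to strip a \<open>k\<close>-matching from
  its defect-\<open>d\<close> extension.\<close>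

lemma matching_disjoint_part:
  assumes "matching G M" "N \<subseteq> M"
  shows "\<Union>(M - N) = \<Union>M - \<Union>N"
proof -
  have "e \<inter> f = {}" if "e \<in> M - N" "f \<in> N" for e f
    using assms that matching_edges_disjoint[of G M e f] by blast
  then show ?thesis by blast
qed

section \<open>Reachability classes as vertex sets of components\<close>

abbreviation reach :: "'a ugraph \<Rightarrow> 'a \<Rightarrow> 'a set" where
  "reach G x \<equiv> (adjacency G)\<^sup>* `` {x}"

lemma sym_adjacency: "sym (adjacency G)"
  by (auto simp: adjacency_def sym_def insert_commute)

lemma reach_sym: "(x, y) \<in> (adjacency G)\<^sup>* \<Longrightarrow> (y, x) \<in> (adjacency G)\<^sup>*"
  using sym_rtrancl[OF sym_adjacency] by (rule symD)

lemma reach_eq: "y \<in> reach G x \<Longrightarrow> reach G y = reach G x"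
  by (auto dest: reach_sym intro: rtrancl_trans)

lemma closed_imp_reach_subset:
  assumes "x \<in> R" "\<And>a b. a \<in> R \<Longrightarrow> (a, b) \<in> adjacency G \<Longrightarrow> b \<in> R"
  shows "reach G x \<subseteq> R"
proof
  fix y assume "y \<in> reach G x"
  then have "(x, y) \<in> (adjacency G)\<^sup>*" by simp
  then show "y \<in> R" by induction (use assms in auto)
qed

lemma reach_subset_verts:
  assumes "simple_graph G" "x \<in> verts G"
  shows "reach G x \<subseteq> verts G"
  using assms by (intro closed_imp_reach_subset) (auto simp: adjacency_def simple_graph_def)

lemma edge_in_reach:
  assumes "simple_graph G" "e \<in> edges G" "e \<inter> reach G x \<noteq> {}"
  shows "e \<subseteq> reach G x"
proof -
  have "card e = 2" using assms by (simp add: simple_graph_def)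
  then obtain a b where e: "e = {a, b}" by (auto simp: card_2_iff)
  then have "(a, b) \<in> adjacency G" "(b, a) \<in> adjacency G"
    using assms(2) by (auto simp: adjacency_def insert_commute)
  then show ?thesis using assms(3) e by (auto intro: rtrancl_into_rtrancl)
qed

lemma verts_component:
  assumes "simple_graph G" "x \<in> verts G"
  shows "verts (induced G (reach G x)) = reach G x"
  using reach_subset_verts[OF assms] by (auto simp: induced_def)

lemma finite_components: "simple_graph G \<Longrightarrow> finite (components G)"
  by (simp add: components_def simple_graph_def)

lemma induced_reach_in_components: "x \<in> verts G \<Longrightarrow> induced G (reach G x) \<in> components G"
  by (auto simp: components_def)

lemma component_eq:
  assumes "simple_graph G" "C \<in> components G" "x \<in> verts C"
  shows "x \<in> verts G" "C = induced G (reach G x)"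
proof -
  obtain y where y: "y \<in> verts G" "C = induced G (reach G y)"
    using assms(2) by (auto simp: components_def)
  then have "x \<in> reach G y" using assms verts_component by metis
  then show "C = induced G (reach G x)" using y reach_eq by metis
  show "x \<in> verts G" using assms(3) y by (auto simp: induced_def)
qed

text \<open>No edge leaves a reachability class, so the covered vertices of a class are exactly
  those covered by the matching edges lying inside it. This gives the parity facts behind both
  directions.\<close>

lemma matching_Int_reach:
  fixes G :: "'a ugraph" and x :: 'a
  assumes "simple_graph G" "matching G M"
  defines "N \<equiv> {e \<in> M. e \<subseteq> reach G x}"
  shows "\<Union>N = \<Union>M \<inter> reach G x" "even (card (\<Union>M \<inter> reach G x))"
proof -
  show eq: "\<Union>N = \<Union>M \<inter> reach G x"
  proof
    show "\<Union>M \<inter> reach G x \<subseteq> \<Union>N"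
    proof
      fix y assume "y \<in> \<Union>M \<inter> reach G x"
      then obtain e where "e \<in> M" "y \<in> e" "y \<in> reach G x" by blast
      moreover have "e \<subseteq> reach G x"
        using edge_in_reach[OF assms(1), of e x] assms(2) calculation by (auto simp: matching_def)
      ultimately show "y \<in> \<Union>N" by (auto simp: N_def)
    qed
  qed (auto simp: N_def)
  have "matching G N" using matching_subset[OF assms(2)] by (auto simp: N_def)
  then show "even (card (\<Union>M \<inter> reach G x))"
    using card_Union_matching[OF assms(1)] eq by (metis dvd_triv_left)
qed

lemma odd_component_uncovered:
  assumes "simple_graph G" "matching G M" "C \<in> components G" "odd (card (verts C))"
  obtains x where "x \<in> verts C" "x \<notin> \<Union>M"
proof -
  obtain y where y: "y \<in> verts G" "C = induced G (reach G y)"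
    using assms(3) by (auto simp: components_def)
  then have "verts C = reach G y" using verts_component assms(1) by metis
  then have "\<Union>M \<inter> reach G y \<noteq> reach G y"
    using matching_Int_reach(2)[OF assms(1,2), of y] assms(4) by metis
  then show ?thesis using that \<open>verts C = reach G y\<close> by blast
qed

section \<open>Gallai's lemma\<close>

definition maximum_matching :: "'a ugraph \<Rightarrow> 'a set set \<Rightarrow> bool" where
  "maximum_matching G M \<longleftrightarrow> matching G M \<and> (\<forall>N. matching G N \<longrightarrow> card N \<le> card M)"

text \<open>Otherwise adding the edge would give a larger matching. This is the base case of
  Gallai's lemma: adjacent vertices are never missed together.\<close>

lemma maximum_matching_edge_covered:
  assumes "simple_graph G" "maximum_matching G N" "{a, b} \<in> edges G" "a \<notin> \<Union>N"
  shows "b \<in> \<Union>N"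
proof (rule ccontr)
  assume b: "b \<notin> \<Union>N"
  have N: "matching G N" using assms(2) by (simp add: maximum_matching_def)
  have "finite N" using finite_matching[OF assms(1) N] by simp
  have "matching G (insert {a, b} N)"
    using N assms b by (auto simp: matching_insert)
  moreover have "card (insert {a, b} N) = Suc (card N)"
    using \<open>finite N\<close> assms(4) by (subst card_insert_disjoint) auto
  ultimately show False using assms(2) by (auto simp: maximum_matching_def)
qed

text \<open>If \<open>M\<close> missed both \<open>x\<close> and \<open>y\<close>, take a maximum matching \<open>N\<close> missing \<open>z\<close> that agrees with \<open>M\<close> in as
  many edges as possible. Some \<open>a \<noteq> z\<close> is covered by \<open>M\<close> but not by \<open>N\<close>, and exchanging one edge
  of \<open>N\<close> for the edge of \<open>M\<close> at \<open>a\<close> increases the agreement.\<close>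

lemma missed_together_trans:
  assumes G: "simple_graph G"
    and z: "\<exists>N. maximum_matching G N \<and> z \<notin> \<Union>N"
    and xz: "\<And>N. maximum_matching G N \<Longrightarrow> x \<notin> \<Union>N \<Longrightarrow> z \<notin> \<Union>N \<Longrightarrow> x = z"
    and zy: "\<And>N. maximum_matching G N \<Longrightarrow> z \<notin> \<Union>N \<Longrightarrow> y \<notin> \<Union>N \<Longrightarrow> z = y"
    and M: "maximum_matching G M" "x \<notin> \<Union>M" "y \<notin> \<Union>M"
  shows "x = y"
proof (rule ccontr)
  assume "x \<noteq> y"
  then have neq: "x \<noteq> z" "z \<noteq> y" using xz zy M by blast+
  have mM: "matching G M" using M by (simp add: maximum_matching_def)
  note finM = finite_matching[OF G mM]
  let ?P = "\<lambda>N. maximum_matching G N \<and> z \<notin> \<Union>N"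
  obtain N0 where N0: "?P N0" using z by blast
  \<comment> \<open>The agreement with \<open>M\<close> is bounded, so a matching \<open>N\<close>
    of greatest agreement exists.\<close>
  have "\<forall>N. ?P N \<longrightarrow> card (M \<inter> N) < Suc (card M)"
    using finM by (simp add: card_mono less_Suc_eq_le)
  from ex_has_greatest_nat[of ?P, OF N0 this]
  obtain N where N: "maximum_matching G N" "z \<notin> \<Union>N"
    and greatest: "\<And>N'. maximum_matching G N' \<Longrightarrow> z \<notin> \<Union>N' \<Longrightarrow> card (M \<inter> N') \<le> card (M \<inter> N)"
    by blast
  have mN: "matching G N" using N by (simp add: maximum_matching_def)
  note finN = finite_matching[OF G mN]
  have xyN: "x \<in> \<Union>N" "y \<in> \<Union>N" using N xz zy neq by blast+
  have "card M = card N"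
    using M(1) N(1) by (meson maximum_matching_def le_antisym)
  then have card_eq: "card (\<Union>M) = card (\<Union>N)"
    using card_Union_matching[OF G] mM mN by simp
  \<comment> \<open>\<open>M\<close> and \<open>N\<close> cover equally many vertices, but
    \<open>N\<close> covers \<open>x\<close> and \<open>y\<close>, which \<open>M\<close> misses. So
    at least two vertices are covered by \<open>M\<close> alone, and one of them differs from
    \<open>z\<close>.\<close>
  have "\<exists>a. a \<in> \<Union>M \<and> a \<notin> \<Union>N \<and> a \<noteq> z"
  proof (rule ccontr)
    assume "\<not> ?thesis"
    then have "\<Union>M \<subseteq> insert z (\<Union>N - {x, y})" using M by blast
    then have "card (\<Union>M) \<le> card (insert z (\<Union>N - {x, y}))"
      using finN by (intro card_mono) auto
    also have "\<dots> \<le> Suc (card (\<Union>N - {x, y}))" by (simp add: card_insert_if finN)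
    also have "card (\<Union>N - {x, y}) = card (\<Union>N) - 2"
      using xyN \<open>x \<noteq> y\<close> by (subst card_Diff_subset) auto
    finally have "card (\<Union>N) \<le> Suc (card (\<Union>N) - 2)" using card_eq by simp
    moreover have "card {x, y} \<le> card (\<Union>N)" using xyN finN by (intro card_mono) auto
    then have "2 \<le> card (\<Union>N)" using \<open>x \<noteq> y\<close> by simp
    ultimately show False by linarith
  qed
  then obtain a e where a: "a \<in> e" "e \<in> M" "a \<notin> \<Union>N" "a \<noteq> z" by blast
  have e_edge: "e \<in> edges G" using a mM by (auto simp: matching_def)
  then have "card e = 2" using G by (simp add: simple_graph_def)
  then obtain b where e: "e = {a, b}" "a \<noteq> b" using a(1) by (auto simp: card_2_iff)
  have "b \<in> \<Union>N"
    using maximum_matching_edge_covered[OF G N(1)] e_edge e a by blast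
  then obtain f where f: "f \<in> N" "b \<in> f" by blast
  have f_only: "b \<notin> g" if "g \<in> N - {f}" for g
    using that f matching_edges_disjoint[OF mN, of f g] by blast
  let ?N = "insert e (N - {f})"
  have "e \<inter> g = {}" if "g \<in> N - {f}" for g
    using f_only[OF that] a e that by blast
  then have m: "matching G ?N"
    using e_edge matching_subset[OF mN, of "N - {f}"] by (auto simp: matching_insert)
  have "e \<notin> N" using a by blast
  then have "card ?N = card N" using finN card_Suc_Diff1[OF finN(1) f(1)] by simp
  then have "maximum_matching G ?N" using m N(1) by (simp add: maximum_matching_def)
  moreover have "z \<notin> \<Union>?N" using N(2) e a \<open>b \<in> \<Union>N\<close> by blast
  ultimately have le: "card (M \<inter> ?N) \<le> card (M \<inter> N)" by (rule greatest)
  have "f \<notin> M"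
  proof
    assume "f \<in> M"
    moreover have "f \<noteq> e" "f \<inter> e \<noteq> {}" using f a e by auto
    ultimately show False using matching_edges_disjoint[OF mM _ a(2)] by blast
  qed
  then have "M \<inter> ?N = insert e (M \<inter> N)" using a by blast
  then have "card (M \<inter> ?N) = Suc (card (M \<inter> N))" using finM \<open>e \<notin> N\<close> by simp
  then show False using le by simp
qed

text \<open>Induction along a path from \<open>x\<close>: its last edge joins \<open>z\<close> to
  \<open>y\<close>, and these two are never missed together. By induction neither are
  \<open>x\<close> and \<open>z\<close>, so \<open>missed_together_trans\<close> applies with
  \<open>z\<close> in the middle. The matching must stay arbitrary, since the hypothesis is applied
  to other maximum matchings.\<close>

lemma gallai_missed_unique:
  assumes G: "simple_graph G"
    and miss: "\<And>w. w \<in> verts G \<Longrightarrow> \<exists>N. maximum_matching G N \<and> w \<notin> \<Union>N"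
    and "maximum_matching G M" "x \<notin> \<Union>M" "y \<notin> \<Union>M" "(x, y) \<in> (adjacency G)\<^sup>*"
  shows "x = y"
  using assms(6,3-5)
proof (induction arbitrary: M rule: rtrancl_induct)
  case (step z y)
  have edge: "{z, y} \<in> edges G" using step by (simp add: adjacency_def)
  then have "z \<in> verts G" using G by (auto simp: simple_graph_def)
  show ?case
  proof (rule missed_together_trans[OF G miss[OF \<open>z \<in> verts G\<close>] _ _ step.prems])
    show "x = z" if "maximum_matching G N" "x \<notin> \<Union>N" "z \<notin> \<Union>N" for N
      using step.IH that by blast
    show "z = y" if "maximum_matching G N" "z \<notin> \<Union>N" "y \<notin> \<Union>N" for N
      using maximum_matching_edge_covered[OF G that(1) edge that(2)] that(3) by blast
  qed
qed simp

text \<open>A maximum matching missing \<open>x\<close> covers all other vertices of the component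
  of \<open>x\<close>, by uniqueness. Its edges inside the component therefore match everything but
  \<open>x\<close>, which gives both factor-criticality and oddness.\<close>

lemma gallai_factor_critical:
  assumes G: "simple_graph G"
    and miss: "\<And>w. w \<in> verts G \<Longrightarrow> \<exists>N. maximum_matching G N \<and> w \<notin> \<Union>N"
    and C: "C \<in> components G"
  shows "odd (card (verts C)) \<and> factor_critical C"
proof -
  have key: "\<exists>M. perfect_matching (delete_verts C {x}) M \<and> odd (card (verts C))"
    if x: "x \<in> verts C" for x
  proof -
    note xG = component_eq[OF G C x]
    have vC: "verts C = reach G x" using verts_component[OF G xG(1)] xG(2) by simp
    obtain N where N: "maximum_matching G N" "x \<notin> \<Union>N" using miss xG by blast
    then have mN: "matching G N" by (simp add: maximum_matching_def)
    have cov: "\<Union>N \<inter> reach G x = reach G x - {x}"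
    proof -
      have "y = x" if "y \<in> reach G x" "y \<notin> \<Union>N" for y
        using gallai_missed_unique[OF G miss N(1) N(2) that(2)] that(1) by auto
      then show ?thesis using N(2) by blast
    qed
    let ?N = "{e \<in> N. e \<subseteq> reach G x}"
    have un: "\<Union>?N = reach G x - {x}" using matching_Int_reach(1)[OF G mN, of x] cov by simp
    have "?N \<subseteq> edges (delete_verts C {x})"
    proof
      fix e assume e: "e \<in> ?N"
      then have "e \<in> edges G" using mN by (auto simp: matching_def)
      moreover have "e \<subseteq> reach G x - {x}" using un e by blast
      ultimately show "e \<in> edges (delete_verts C {x})"
        using vC xG(2) by (auto simp: edges_delete_verts induced_def)
    qed
    then have "matching (delete_verts C {x}) ?N"
      using matching_subset[OF mN, of ?N] by (auto simp: matching_def)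
    then have pm: "perfect_matching (delete_verts C {x}) ?N"
      using un vC by (simp add: perfect_matching_def)
    have "finite (reach G x)"
      using reach_subset_verts[OF G xG(1)] G finite_subset by (auto simp: simple_graph_def)
    moreover have "even (card (reach G x - {x}))" using matching_Int_reach(2)[OF G mN, of x] cov by simp
    ultimately have "odd (card (verts C))"
      using vC card_Suc_Diff1[of "reach G x" x] by (metis Image_singleton_iff even_Suc rtrancl.rtrancl_refl)
    then show ?thesis using pm by blast
  qed
  \<comment> \<open>Oddness was derived from a chosen vertex, so the component must be shown to be
    nonempty.\<close>
  obtain y where "y \<in> verts C"
    using C verts_component[OF G] by (force simp: components_def)
  then show ?thesis using key by (auto simp: factor_critical_def)
qed

text \<open>Sending each missed vertex to its component is a bijection: injective because no
  component contains two missed vertices, surjective because an odd component cannot be covered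
  completely.\<close>

lemma gallai_card_components:
  assumes G: "simple_graph G"
    and miss: "\<And>w. w \<in> verts G \<Longrightarrow> \<exists>N. maximum_matching G N \<and> w \<notin> \<Union>N"
    and M: "maximum_matching G M"
  shows "card (components G) = card (verts G - \<Union>M)"
proof -
  let ?f = "\<lambda>x. induced G (reach G x)"
  have mM: "matching G M" using M by (simp add: maximum_matching_def)
  have "inj_on ?f (verts G - \<Union>M)"
  proof (rule inj_onI)
    fix x y assume xy: "x \<in> verts G - \<Union>M" "y \<in> verts G - \<Union>M" "?f x = ?f y"
    then have "reach G x = reach G y" using verts_component[OF G] by (metis DiffD1)
    then have "(x, y) \<in> (adjacency G)\<^sup>*" by blast
    then show "x = y" using gallai_missed_unique[OF G miss M] xy by blast
  qed
  moreover have "?f ` (verts G - \<Union>M) = components G"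
  proof
    show "components G \<subseteq> ?f ` (verts G - \<Union>M)"
    proof
      fix C assume C: "C \<in> components G"
      then obtain x where "x \<in> verts C" "x \<notin> \<Union>M"
        using odd_component_uncovered[OF G mM] gallai_factor_critical[OF G miss] by metis
      then show "C \<in> ?f ` (verts G - \<Union>M)" using component_eq[OF G C] by blast
    qed
  qed (auto simp: components_def)
  ultimately show ?thesis by (metis card_image)
qed

section \<open>Deleting an edge of an \<open>(n,k,d)\<close>-graph\<close>

text \<open>If deleting \<open>uv\<close> isolates both ends, then \<open>uv\<close> was the only
  edge at \<open>u\<close> or \<open>v\<close>. Restoring it merges two singleton components and
  leaves all others alone, so results on components carry over from the graph without
  \<open>uv\<close>.\<close>

lemma components_delete_isolating_edge:
  assumes G: "simple_graph G" and uv: "{u, v} \<in> edges G"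
    and iso: "reach (delete_edge G {u, v}) u = {u}" "reach (delete_edge G {u, v}) v = {v}"
  shows "({u, v}, {{u, v}}) \<in> components G"
    and "components G - {({u, v}, {{u, v}})} =
         components (delete_edge G {u, v}) - {({u}, {}), ({v}, {})}"
    and "({u}, {}) \<in> components (delete_edge G {u, v})"
    and "({v}, {}) \<in> components (delete_edge G {u, v})"
proof -
  let ?H = "delete_edge G {u, v}"
  have "card {u, v} = 2" and verts: "u \<in> verts G" "v \<in> verts G"
    using G uv by (auto simp: simple_graph_def)
  then have "u \<noteq> v" by auto
  have H: "simple_graph ?H" using simple_graph_delete_edge[OF G] .
  \<comment> \<open>Any other edge at \<open>u\<close> or \<open>v\<close> would survive the
    deletion and lie inside a one-vertex class.\<close>
  have only: "e = {u, v}" if e: "e \<in> edges G" "e \<inter> {u, v} \<noteq> {}" for e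
  proof (rule ccontr)
    assume "e \<noteq> {u, v}"
    then have "e \<in> edges ?H" using e by simp
    then have "e \<subseteq> {u} \<or> e \<subseteq> {v}"
      using edge_in_reach[OF H, of e u] edge_in_reach[OF H, of e v] iso e(2) by auto
    then have "card e \<le> 1" using card_mono[of "{u}" e] card_mono[of "{v}" e] by auto
    then show False using G e by (auto simp: simple_graph_def)
  qed
  have adj: "(a, b) \<in> adjacency ?H"
    if "(a, b) \<in> adjacency G" "a \<notin> {u, v}" for a b
    using that by (auto simp: adjacency_def doubleton_eq_iff)
  have reach_uv: "reach G x = {u, v}" if "x \<in> {u, v}" for x
  proof
    have "b \<in> {u, v}" if "a \<in> {u, v}" "(a, b) \<in> adjacency G" for a b
      using only[of "{a, b}"] that by (auto simp: adjacency_def)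
    then show "reach G x \<subseteq> {u, v}" by (rule closed_imp_reach_subset[OF that])
    have "(u, v) \<in> adjacency G" "(v, u) \<in> adjacency G"
      using uv by (auto simp: adjacency_def insert_commute)
    then show "{u, v} \<subseteq> reach G x" using that by auto
  qed
  have reach_other: "reach G w = reach ?H w \<and> reach G w \<inter> {u, v} = {}" if w: "w \<notin> {u, v}" for w
  proof -
    have no: "reach ?H w \<inter> {u, v} = {}"
    proof (rule ccontr)
      assume "\<not> ?thesis"
      then obtain t where "t \<in> {u, v}" "t \<in> reach ?H w" by blast
      then have "w \<in> reach ?H t" by (auto intro: reach_sym)
      then show False using iso w \<open>t \<in> {u, v}\<close> by auto
    qed
    have "reach G w \<subseteq> reach ?H w"
    proof (rule closed_imp_reach_subset)
      fix a b assume a: "a \<in> reach ?H w" "(a, b) \<in> adjacency G"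
      then have "(a, b) \<in> adjacency ?H" using adj no by blast
      then show "b \<in> reach ?H w" using a(1) by (auto intro: rtrancl_into_rtrancl)
    qed simp
    moreover have "reach ?H w \<subseteq> reach G w"
    proof (rule closed_imp_reach_subset)
      fix a b assume a: "a \<in> reach G w" "(a, b) \<in> adjacency ?H"
      then have "(a, b) \<in> adjacency G" by (auto simp: adjacency_def)
      then show "b \<in> reach G w" using a(1) by (auto intro: rtrancl_into_rtrancl)
    qed simp
    ultimately show ?thesis using no by blast
  qed
  have ind_uv: "induced G (reach G x) = ({u, v}, {{u, v}})" if "x \<in> {u, v}" for x
  proof -
    have "e = {u, v}" if "e \<in> edges G" "e \<subseteq> {u, v}" for e
    proof (rule only[OF that(1)])
      have "e \<noteq> {}" using G that(1) by (force simp: simple_graph_def)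
      then show "e \<inter> {u, v} \<noteq> {}" using that(2) by blast
    qed
    then show ?thesis unfolding reach_uv[OF that] using uv verts by (auto simp: induced_def)
  qed
  have ind_H: "induced ?H (reach ?H x) = ({x}, {})" if "x \<in> {u, v}" for x
  proof -
    have r: "reach ?H x = {x}" using that iso by auto
    have "\<not> e \<subseteq> {x}" if "e \<in> edges G" for e
    proof
      assume "e \<subseteq> {x}"
      then have "card e \<le> card {x}" by (intro card_mono) auto
      then show False using G that by (auto simp: simple_graph_def)
    qed
    then show ?thesis unfolding r using that verts by (auto simp: induced_def)
  qed
  have ind_other: "induced G (reach G w) = induced ?H (reach ?H w)
      \<and> verts (induced G (reach G w)) \<inter> {u, v} = {}" if "w \<notin> {u, v}" for w
  proof -
    have "reach G w = reach ?H w" and no: "reach G w \<inter> {u, v} = {}" using reach_other[OF that] by auto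
    then show ?thesis by (auto simp: induced_def)
  qed
  show "({u, v}, {{u, v}}) \<in> components G"
    using induced_reach_in_components[OF verts(1)] unfolding ind_uv[OF insertI1] .
  show "({u}, {}) \<in> components ?H"
    using induced_reach_in_components[of u ?H] verts(1) unfolding ind_H[OF insertI1] by simp
  show "({v}, {}) \<in> components ?H"
    using induced_reach_in_components[of v ?H] verts(2) unfolding ind_H[OF insertI2[OF singletonI]] by simp
  have "components G - {({u, v}, {{u, v}})} = (\<lambda>w. induced G (reach G w)) ` (verts G - {u, v})"
  proof -
    have "components G = insert ({u, v}, {{u, v}}) ((\<lambda>w. induced G (reach G w)) ` (verts G - {u, v}))"
    proof -
      have eq: "{u, v} \<union> (verts G - {u, v}) = verts G" using verts by blast
      have "components G = (\<lambda>w. induced G (reach G w)) ` {u, v}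
          \<union> (\<lambda>w. induced G (reach G w)) ` (verts G - {u, v})"
        unfolding components_def image_Un[symmetric] eq ..
      moreover have "(\<lambda>w. induced G (reach G w)) ` {u, v} = {({u, v}, {{u, v}})}"
        using ind_uv by auto
      ultimately show ?thesis by simp
    qed
    moreover have "({u, v}, {{u, v}}) \<notin> (\<lambda>w. induced G (reach G w)) ` (verts G - {u, v})"
    proof
      assume "({u, v}, {{u, v}}) \<in> (\<lambda>w. induced G (reach G w)) ` (verts G - {u, v})"
      then obtain w where "w \<notin> {u, v}" "induced G (reach G w) = ({u, v}, {{u, v}})"
        by (elim imageE DiffE) simp
      then show False using ind_other[of w] by auto
    qed
    ultimately show ?thesis by blast
  qed
  also have "\<dots> = (\<lambda>w. induced ?H (reach ?H w)) ` (verts G - {u, v})"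
    using ind_other by (intro image_cong) auto
  also have "\<dots> = components ?H - {({u}, {}), ({v}, {})}"
  proof -
    have "components ?H = {({u}, {}), ({v}, {})} \<union> (\<lambda>w. induced ?H (reach ?H w)) ` (verts G - {u, v})"
    proof -
      have eq: "{u, v} \<union> (verts G - {u, v}) = verts ?H" using verts by auto
      have "components ?H = (\<lambda>w. induced ?H (reach ?H w)) ` {u, v}
          \<union> (\<lambda>w. induced ?H (reach ?H w)) ` (verts G - {u, v})"
        unfolding components_def image_Un[symmetric] eq ..
      moreover have "(\<lambda>w. induced ?H (reach ?H w)) ` {u, v} = {({u}, {}), ({v}, {})}"
        using ind_H by auto
      ultimately show ?thesis by (simp only:)
    qed
    moreover have "C \<notin> (\<lambda>w. induced ?H (reach ?H w)) ` (verts G - {u, v})"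
      if "C \<in> {({u}, {}), ({v}, {})}" for C
    proof
      assume "C \<in> (\<lambda>w. induced ?H (reach ?H w)) ` (verts G - {u, v})"
      then obtain w where w: "w \<notin> {u, v}" "C = induced ?H (reach ?H w)" by blast
      have "verts C \<inter> {u, v} = {}"
        using conjunct1[OF ind_other[OF w(1)]] conjunct2[OF ind_other[OF w(1)]] w(2) by (simp only:)
      then show False using that by auto
    qed
    ultimately show ?thesis by blast
  qed
  finally show "components G - {({u, v}, {{u, v}})} = components ?H - {({u}, {}), ({v}, {})}" .
qed

section \<open>Matchings left after deleting \<open>n - 2\<close> vertices and a
  \<open>k\<close>-matching\<close>

lemma card_Diff_add: "finite V \<Longrightarrow> A \<subseteq> V \<Longrightarrow> card (V - A) + card A = card V"
  by (metis card_Diff_subset card_mono finite_subset le_add_diff_inverse2)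

text \<open>\<open>T\<close> together with \<open>x\<close> and \<open>y\<close> is an admissible
  set of \<open>n = p + 2\<close> vertices, and \<open>M\<close> avoids it. Removing
  \<open>M\<close> from its defect-\<open>d\<close> extension leaves a matching for which
  \<open>x\<close> and \<open>y\<close> count as two further missed vertices.\<close>

lemma defect_matching_minus_two:
  assumes G: "simple_graph G" and nkd: "nkd_graph (Suc (Suc p)) k d G"
    and T: "T \<subseteq> verts G" "card T = p"
    and M: "k_matching k (delete_verts G T) M"
    and xy: "x \<in> verts G - (T \<union> \<Union>M)" "y \<in> verts G - (T \<union> \<Union>M)" "x \<noteq> y"
  shows "\<exists>N. matching (delete_verts G (T \<union> \<Union>M)) N \<and> x \<notin> \<Union>N \<and> y \<notin> \<Union>N \<and>
    card (\<Union>N) + d + 2 = card (verts G - (T \<union> \<Union>M))"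
proof -
  have fin: "finite (verts G)" using G by (simp add: simple_graph_def)
  have finT: "finite T" using T fin finite_subset by blast
  let ?T = "T \<union> {x, y}"
  have cT: "?T \<subseteq> verts G" "card ?T = Suc (Suc p)" using T xy finT by auto
  have mM: "matching G M" "\<Union>M \<inter> T = {}" "card M = k"
    using M by (auto simp: k_matching_def matching_delete_verts[OF G])
  have "k_matching k (delete_verts G ?T) M"
    using mM xy by (auto simp: k_matching_def matching_delete_verts[OF G])
  then obtain M' where M': "M \<subseteq> M'" "defect_matching d (delete_verts G ?T) M'"
    using nkd cT unfolding nkd_graph_def by blast
  then have mM': "matching G M'" "\<Union>M' \<inter> ?T = {}"
    and card': "card (\<Union>M') + d = card (verts G - ?T)"
    by (auto simp: defect_matching_def matching_delete_verts[OF G])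
  let ?N = "M' - M"
  have un: "\<Union>?N = \<Union>M' - \<Union>M" using matching_disjoint_part[OF mM'(1) M'(1)] .
  have "matching (delete_verts G (T \<union> \<Union>M)) ?N"
    using matching_subset[OF mM'(1), of ?N] mM'(2) un by (auto simp: matching_delete_verts[OF G])
  moreover have "x \<notin> \<Union>?N" "y \<notin> \<Union>?N" using mM'(2) by auto
  moreover have "card (\<Union>?N) + d + 2 = card (verts G - (T \<union> \<Union>M))"
  proof -
    have finM: "finite (\<Union>M)" "finite (\<Union>M')" using finite_matching[OF G] mM mM' by auto
    have MV: "\<Union>M \<subseteq> verts G" using matching_Union_subset[OF G mM(1)] .
    have sub: "\<Union>M \<subseteq> \<Union>M'" using M'(1) by blast
    have 1: "card (\<Union>?N) + card (\<Union>M) = card (\<Union>M')"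
      unfolding un using card_Diff_add[OF finM(2) sub] .
    have 2: "card (verts G - ?T) + card ?T = card (verts G)"
      using card_Diff_add[OF fin cT(1)] .
    have TM: "T \<union> \<Union>M \<subseteq> verts G" using T MV by blast
    have 3: "card (verts G - (T \<union> \<Union>M)) + card (T \<union> \<Union>M) = card (verts G)"
      using card_Diff_add[OF fin TM] .
    have 4: "card (T \<union> \<Union>M) = p + card (\<Union>M)"
      using T mM finT finM by (subst card_Un_disjoint) auto
    show ?thesis using 1 2 3 4 cT(2) card' by linarith
  qed
  ultimately show ?thesis by blast
qed

text \<open>The size and parity conditions and the existence of \<open>k\<close>-matchings all pass
  to \<open>n - 2\<close> and \<open>G - uv\<close>. Hence only the extension property can fail, and
  \<open>T\<close> and \<open>M\<close> witness this failure.\<close>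

lemma not_nkd_graphD:
  assumes G: "simple_graph G" and nkd: "nkd_graph (Suc (Suc p)) k d G"
    and uv: "{u, v} \<in> edges G" and not: "\<not> nkd_graph p k d (delete_edge G {u, v})"
  obtains T M where "T \<subseteq> verts G" "card T = p" "k_matching k (delete_verts G T) M" "{u, v} \<notin> M"
    "\<And>N. matching (delete_verts G (T \<union> \<Union>M)) N \<Longrightarrow> {u, v} \<notin> N \<Longrightarrow>
      card (\<Union>N) + d \<noteq> card (verts G - (T \<union> \<Union>M))"
proof -
  let ?H = "delete_edge G {u, v}"
  have fin: "finite (verts G)" using G by (simp add: simple_graph_def)
  have uG: "u \<in> verts G" using G uv by (auto simp: simple_graph_def)
  have big: "card (verts G) \<ge> Suc (Suc p) + 2 * k + d + 2" "even (card (verts G) - Suc (Suc p) - d)"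
    using nkd unfolding nkd_graph_def by blast+
  have "card (verts G) - p - d = Suc (Suc (card (verts G) - Suc (Suc p) - d))" using big(1) by linarith
  then have size: "card (verts ?H) \<ge> p + 2 * k + d + 2" "even (card (verts ?H) - p - d)"
    using big by auto
  \<comment> \<open>\<open>T\<close> is enlarged to \<open>n\<close> vertices in such a way that
    \<open>u\<close> is among them. A \<open>k\<close>-matching avoiding the enlarged set then
    cannot use \<open>uv\<close>.\<close>
  have ex: "\<exists>M. k_matching k (delete_verts ?H T) M" if T: "T \<subseteq> verts G" "card T = p" for T
  proof -
    have finT: "finite T" using T fin finite_subset by blast
    have "card (verts G - T) \<ge> 2"
      using T big(1) by (simp add: card_Diff_subset finT)
    then have "\<exists>R \<subseteq> verts G - T. card R = 2 \<and> u \<in> T \<union> R"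
    proof (cases "u \<in> T")
      case True
      then show ?thesis using \<open>card (verts G - T) \<ge> 2\<close> by (metis UnI1 obtain_subset_with_card_n)
    next
      case False
      have "\<not> verts G - T \<subseteq> {u}"
      proof
        assume "verts G - T \<subseteq> {u}"
        then have "card (verts G - T) \<le> card {u}" by (intro card_mono) auto
        then show False using \<open>card (verts G - T) \<ge> 2\<close> by simp
      qed
      then obtain x where "x \<in> verts G - T" "x \<noteq> u" by blast
      then show ?thesis using False uG by (intro exI[of _ "{u, x}"]) auto
    qed
    then obtain R where R: "R \<subseteq> verts G - T" "card R = 2" "u \<in> T \<union> R" by blast
    then have "finite R" using fin finite_subset by (metis finite_Diff)
    then have "card (T \<union> R) = Suc (Suc p)" using R T finT by (subst card_Un_disjoint) auto
    moreover have "T \<union> R \<subseteq> verts G" using R T by blast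
    ultimately obtain M where M: "k_matching k (delete_verts G (T \<union> R)) M"
      using nkd unfolding nkd_graph_def by blast
    then have "matching G M" "\<Union>M \<inter> (T \<union> R) = {}" "card M = k"
      by (auto simp: k_matching_def matching_delete_verts[OF G])
    moreover from this R have "{u, v} \<notin> M" by blast
    ultimately show ?thesis
      by (auto simp: k_matching_def delete_verts_delete_edge matching_delete_edge
          matching_delete_verts[OF G])
  qed
  obtain T M where T: "T \<subseteq> verts G" "card T = p"
    and M: "k_matching k (delete_verts ?H T) M"
    and noext: "\<And>M'. M \<subseteq> M' \<Longrightarrow> \<not> defect_matching d (delete_verts ?H T) M'"
    using not size ex unfolding nkd_graph_def by (metis verts_delete_edge)
  have mM: "matching G M" "\<Union>M \<inter> T = {}" "card M = k" "{u, v} \<notin> M"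
    using M by (auto simp: k_matching_def delete_verts_delete_edge matching_delete_edge
        matching_delete_verts[OF G])
  show ?thesis
  proof (rule that[OF T])
    show "k_matching k (delete_verts G T) M" "{u, v} \<notin> M"
      using mM by (auto simp: k_matching_def matching_delete_verts[OF G])
    \<comment> \<open>Such an \<open>N\<close> of defect \<open>d\<close> could be joined to
      \<open>M\<close>, giving the extension that does not exist.\<close>
    fix N assume N: "matching (delete_verts G (T \<union> \<Union>M)) N" "{u, v} \<notin> N"
    show "card (\<Union>N) + d \<noteq> card (verts G - (T \<union> \<Union>M))"
    proof
      assume c: "card (\<Union>N) + d = card (verts G - (T \<union> \<Union>M))"
      have mN: "matching G N" "\<Union>N \<inter> (T \<union> \<Union>M) = {}"
        using N by (auto simp: matching_delete_verts[OF G])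
      have fins: "finite (\<Union>M)" "finite (\<Union>N)" using finite_matching[OF G] mN mM by auto
      have "matching G (M \<union> N)" using matching_Un[OF mM(1) mN(1)] mN(2) by blast
      then have m: "matching (delete_verts ?H T) (M \<union> N)"
        using mM mN N(2) by (auto simp: delete_verts_delete_edge matching_delete_edge
            matching_delete_verts[OF G])
      have "card (\<Union>(M \<union> N)) = card (\<Union>M) + card (\<Union>N)"
        using fins mN(2) by (simp only: Union_Un_distrib, subst card_Un_disjoint) auto
      moreover have "card (verts G - T) = card (\<Union>M) + card (verts G - (T \<union> \<Union>M))"
      proof -
        have "verts G - T = \<Union>M \<union> (verts G - (T \<union> \<Union>M))"
          using matching_Union_subset[OF G mM(1)] mM(2) by blast
        moreover have "card (\<Union>M \<union> (verts G - (T \<union> \<Union>M))) = card (\<Union>M) + card (verts G - (T \<union> \<Union>M))"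
          using fins fin by (intro card_Un_disjoint) auto
        ultimately show ?thesis by simp
      qed
      ultimately have "defect_matching d (delete_verts ?H T) (M \<union> N)"
        using m c by (simp add: defect_matching_def)
      then show False using noext by blast
    qed
  qed
qed

section \<open>The two directions of the equivalence\<close>

lemma not_nkd_graph_delete_edge_imp:
  assumes G: "simple_graph G" and nkd: "nkd_graph (Suc (Suc p)) k d G"
    and uv: "{u, v} \<in> edges G" and not: "\<not> nkd_graph p k d (delete_edge G {u, v})"
  shows "\<exists>S. S \<subseteq> verts G \<and> card S = p + 2 * k \<and>
       (\<exists>M. k_matching k (induced G S) M) \<and>
       ({u, v}, {{u, v}}) \<in> components (delete_verts G S) \<and>
       card (components (delete_verts G S) - {({u, v}, {{u, v}})}) = d \<and>
       (\<forall>C \<in> components (delete_verts G S) - {({u, v}, {{u, v}})}.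
          odd (card (verts C)) \<and> factor_critical C)"
proof -
  obtain T M where T: "T \<subseteq> verts G" "card T = p"
    and M: "k_matching k (delete_verts G T) M" "{u, v} \<notin> M"
    and nodef: "\<And>N. matching (delete_verts G (T \<union> \<Union>M)) N \<Longrightarrow> {u, v} \<notin> N \<Longrightarrow>
      card (\<Union>N) + d \<noteq> card (verts G - (T \<union> \<Union>M))"
    using not_nkd_graphD[OF G nkd uv not] by metis
  define S where "S = T \<union> \<Union>M"
  define H where "H = delete_verts G S"
  have H: "simple_graph H" using simple_graph_delete_verts[OF G] by (simp add: H_def)
  have vH: "verts H = verts G - S" by (simp add: H_def)
  have fin: "finite (verts G)" using G by (simp add: simple_graph_def)
  have mM: "matching G M" "\<Union>M \<inter> T = {}" "card M = k"
    using M by (auto simp: k_matching_def matching_delete_verts[OF G])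
  have SV: "S \<subseteq> verts G" using matching_Union_subset[OF G mM(1)] T by (simp add: S_def)
  have finS: "finite S" using SV fin finite_subset by blast
  have cS: "card S = p + 2 * k"
    unfolding S_def using T mM finS card_Union_matching[OF G mM(1)]
    by (subst card_Un_disjoint) (auto simp: S_def)
  have cH: "card (verts H) + (p + 2 * k) = card (verts G)"
    using card_Diff_add[OF fin SV] cS vH by simp
  have big: "card (verts G) \<ge> Suc (Suc p) + 2 * k + d + 2" "even (card (verts G) - Suc (Suc p) - d)"
    using nkd unfolding nkd_graph_def by blast+
  have cH4: "card (verts H) \<ge> d + 4" using cH big by linarith
  have par: "even (card (verts H) - d)"
  proof -
    have "card (verts H) - d = (card (verts G) - Suc (Suc p) - d) + 2 - 2 * k"
      using cH big(1) by linarith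
    then show ?thesis using big(2) by auto
  qed
  have two: "\<exists>N. matching H N \<and> x \<notin> \<Union>N \<and> y \<notin> \<Union>N \<and> card (\<Union>N) + d + 2 = card (verts H)"
    if "x \<in> verts H" "y \<in> verts H" "x \<noteq> y" for x y
    using defect_matching_minus_two[OF G nkd T M(1), of x y] that by (simp add: vH H_def S_def)
  have nodefH: "card (\<Union>N) + d \<noteq> card (verts H)" if "matching H N" "{u, v} \<notin> N" for N
    using nodef that by (simp add: H_def S_def)
  \<comment> \<open>If an end of \<open>uv\<close> lay in \<open>S\<close>, no matching of
    \<open>H\<close> could use \<open>uv\<close>. Adding any edge \<open>ab\<close> of
    \<open>H\<close> to a matching of defect \<open>d + 2\<close> that misses \<open>a\<close> and
    \<open>b\<close> would then give the forbidden defect \<open>d\<close>. Such an edge exists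
    because \<open>H\<close> has at least \<open>d + 4\<close> vertices.\<close>
  have uvH: "u \<in> verts H \<and> v \<in> verts H"
  proof (rule ccontr)
    assume out: "\<not> ?thesis"
    have noedge: "{u, v} \<notin> N" if "matching H N" for N
      using matching_Union_subset[OF H that] out by blast
    have "\<not> card (verts H) \<le> 1" using cH4 by linarith
    then obtain x y where xy: "x \<in> verts H" "y \<in> verts H" "x \<noteq> y"
      by (metis card_le_Suc0_iff_eq One_nat_def H simple_graph_def)
    obtain N where N: "matching H N" "card (\<Union>N) + d + 2 = card (verts H)"
      using two[OF xy] by blast
    then have "card (\<Union>N) \<noteq> 0" using cH4 by linarith
    then have "\<Union>N \<noteq> {}" by force
    then obtain e where "e \<in> N" by blast
    then have e: "e \<in> edges H" using N by (auto simp: matching_def)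
    then have ce: "e \<subseteq> verts H" "card e = 2" using H by (auto simp: simple_graph_def)
    then obtain a b where ab: "e = {a, b}" "a \<noteq> b" by (auto simp: card_2_iff)
    then have "a \<in> verts H" "b \<in> verts H" using ce by auto
    from two[OF this \<open>a \<noteq> b\<close>]
    obtain N' where N': "matching H N'" "a \<notin> \<Union>N'" "b \<notin> \<Union>N'" "card (\<Union>N') + d + 2 = card (verts H)"
      by blast
    have "matching H (insert e N')" using N' e ab by (auto simp: matching_insert)
    moreover have "card (\<Union>(insert e N')) = card (\<Union>N') + 2"
      using N' ab finite_matching[OF H N'(1)] by (simp add: ab)
    ultimately show False using nodefH noedge N'(4) by (metis add.assoc add.commute)
  qed
  have "card {u, v} = 2" using G uv by (auto simp: simple_graph_def)
  then have "u \<noteq> v" by auto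
  have uvE: "{u, v} \<in> edges H" using uv uvH by (auto simp: H_def edges_delete_verts)
  define H' where "H' = delete_edge H {u, v}"
  have H': "simple_graph H'" and vH': "verts H' = verts H"
    using simple_graph_delete_edge[OF H] by (auto simp: H'_def)
  have mH': "matching H' N \<longleftrightarrow> matching H N \<and> {u, v} \<notin> N" for N
    by (simp add: H'_def matching_delete_edge)
  \<comment> \<open>By parity, a matching with defect below \<open>d + 2\<close> has defect at most
    \<open>d\<close>. Keeping only \<open>q\<close> of its edges brings the defect to exactly
    \<open>d\<close>, which is excluded.\<close>
  have bound: "card (\<Union>N) + d + 2 \<le> card (verts H)" if N: "matching H' N" for N
  proof (rule ccontr)
    assume less: "\<not> ?thesis"
    have cN: "card (\<Union>N) = 2 * card N" using card_Union_matching[OF H' N] .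
    from par obtain q where q: "card (verts H) - d = 2 * q" by blast
    have "q < card N + 1" using less cN q cH4 by linarith
    then have "q \<le> card N" by simp
    then obtain N' where N': "N' \<subseteq> N" "card N' = q" by (metis obtain_subset_with_card_n)
    then have mN': "matching H' N'" using matching_subset[OF N] by blast
    have "card (\<Union>N') + d = card (verts H)"
      using card_Union_matching[OF H' mN'] N' q cH4 by linarith
    then show False using nodefH mN' by (simp add: mH')
  qed
  have maxi: "maximum_matching H' N" if N: "matching H' N" "card (\<Union>N) + d + 2 = card (verts H)" for N
  proof -
    have "card N' \<le> card N" if "matching H' N'" for N'
      using bound[OF that] N(2) card_Union_matching[OF H'] that N(1) by fastforce
    then show ?thesis using N(1) by (simp add: maximum_matching_def)
  qed
  \<comment> \<open>A matching of \<open>H\<close> missing an end of \<open>uv\<close> does not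
    contain \<open>uv\<close>, so it survives in \<open>H'\<close>.\<close>
  have two': "\<exists>N. maximum_matching H' N \<and> t \<notin> \<Union>N \<and> x \<notin> \<Union>N \<and> card (\<Union>N) + d + 2 = card (verts H)"
    if tx: "t \<in> {u, v}" "x \<in> verts H" "x \<noteq> t" for t x
  proof -
    obtain N where N: "matching H N" "t \<notin> \<Union>N" "x \<notin> \<Union>N" "card (\<Union>N) + d + 2 = card (verts H)"
      using two[of t x] tx uvH by blast
    have "matching H' N" using N tx(1) by (auto simp: mH')
    then show ?thesis using N maxi by blast
  qed
  have miss: "\<exists>N. maximum_matching H' N \<and> w \<notin> \<Union>N" if "w \<in> verts H'" for w
    using two'[of u w] two'[of u v] that vH' uvH \<open>u \<noteq> v\<close> by (cases "w = u") auto
  have iso: "reach H' t = {t}" if t: "t \<in> {u, v}" for t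
  proof -
    have "x = t" if x: "x \<in> reach H' t" for x
    proof (rule ccontr)
      assume "x \<noteq> t"
      moreover have "x \<in> verts H" using reach_subset_verts[OF H', of t] x t uvH vH' by blast
      ultimately obtain N where "maximum_matching H' N" "t \<notin> \<Union>N" "x \<notin> \<Union>N"
        using two'[OF t, of x] by blast
      then have "t = x" using gallai_missed_unique[OF H' miss, of N t x] x by simp
      then show False using \<open>x \<noteq> t\<close> by simp
    qed
    then show ?thesis by auto
  qed
  note comps = components_delete_isolating_edge[OF H uvE, folded H'_def, OF iso iso, simplified]
  obtain N where N: "maximum_matching H' N" "card (\<Union>N) + d + 2 = card (verts H)"
    using two'[of u v] uvH \<open>u \<noteq> v\<close> by auto
  have "card (components H') = card (verts H' - \<Union>N)"
    using gallai_card_components[OF H' miss N(1)] .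
  also have "\<dots> = d + 2"
  proof -
    have "matching H' N" using N by (simp add: maximum_matching_def)
    then have "\<Union>N \<subseteq> verts H'" "finite (\<Union>N)" using matching_Union_subset[OF H'] finite_matching[OF H'] by auto
    then show ?thesis using N(2) vH' by (simp add: card_Diff_subset)
  qed
  \<comment> \<open>Two of the \<open>d + 2\<close> components are the isolated vertices
    \<open>u\<close> and \<open>v\<close>.\<close>
  finally have "card (components H' - {({u}, {}), ({v}, {})}) = d"
    using comps(3,4) \<open>u \<noteq> v\<close> by (subst card_Diff_subset) auto
  moreover have "odd (card (verts C)) \<and> factor_critical C" if "C \<in> components H'" for C
    using gallai_factor_critical[OF H' miss that] .
  moreover have "k_matching k (induced G S) M"
    using mM unfolding k_matching_def matching_def induced_def S_def by auto
  ultimately show ?thesis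
    using SV cS comps(1,2) unfolding H_def by (intro exI[of _ S]) auto
qed

text \<open>An extension avoiding \<open>uv\<close> restricts to a matching of \<open>G - S\<close>
  that misses \<open>u\<close>, \<open>v\<close> and at least one vertex of each of the
  \<open>d\<close> odd components. That is \<open>d + 2\<close> missed vertices where only
  \<open>d\<close> are allowed.\<close>

lemma not_nkd_graph_delete_edge_if:
  assumes G: "simple_graph G" and uv: "{u, v} \<in> edges G"
    and S: "S \<subseteq> verts G" "card S = p + 2 * k" "k_matching k (induced G S) M"
    and edge_comp: "({u, v}, {{u, v}}) \<in> components (delete_verts G S)"
    and count: "card (components (delete_verts G S) - {({u, v}, {{u, v}})}) = d"
    and odd: "\<And>C. C \<in> components (delete_verts G S) - {({u, v}, {{u, v}})} \<Longrightarrow> odd (card (verts C))"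
  shows "\<not> nkd_graph p k d (delete_edge G {u, v})"
proof
  assume nkd: "nkd_graph p k d (delete_edge G {u, v})"
  define H where "H = delete_verts G S"
  have H: "simple_graph H" using simple_graph_delete_verts[OF G] by (simp add: H_def)
  have vH: "verts H = verts G - S" by (simp add: H_def)
  have fin: "finite (verts G)" using G by (simp add: simple_graph_def)
  have finS: "finite S" using S fin finite_subset by blast
  have mM: "matching G M" "\<Union>M \<subseteq> S" "card M = k"
    using S(3) by (auto simp: k_matching_def matching_def induced_def)
  have cM: "card (\<Union>M) = 2 * k" "finite (\<Union>M)"
    using card_Union_matching[OF G mM(1)] finite_matching[OF G mM(1)] mM by auto
  have u: "u \<in> verts H" "{u, v} = reach H u"
    and v: "v \<in> verts H" "{u, v} = reach H v"
    and ind: "({u, v}, {{u, v}}) = induced H (reach H u)"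
    using component_eq[OF H edge_comp[folded H_def]] verts_component[OF H]
    by (metis fst_conv insertCI)+
  have "card {u, v} = 2" using G uv by (auto simp: simple_graph_def)
  then have "u \<noteq> v" by auto
  \<comment> \<open>The part of \<open>S\<close> not covered by \<open>M\<close> has exactly
    \<open>p\<close> vertices, so it is an admissible deletion set.\<close>
  let ?T = "S - \<Union>M"
  have cT: "?T \<subseteq> verts G" "card ?T = p" using S mM cM by (auto simp: card_Diff_subset)
  have "k_matching k (delete_verts (delete_edge G {u, v}) ?T) M"
    using mM u vH by (auto simp: k_matching_def delete_verts_delete_edge matching_delete_edge
        matching_delete_verts[OF G])
  then obtain M' where M': "M \<subseteq> M'" "defect_matching d (delete_verts (delete_edge G {u, v}) ?T) M'"
    using nkd cT unfolding nkd_graph_def by (metis verts_delete_edge)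
  then have mM': "matching G M'" "\<Union>M' \<inter> ?T = {}" "{u, v} \<notin> M'"
    and c': "card (\<Union>M') + d = card (verts G - ?T)"
    by (auto simp: defect_matching_def delete_verts_delete_edge matching_delete_edge
        matching_delete_verts[OF G])
  let ?N = "M' - M"
  have un: "\<Union>?N = \<Union>M' - \<Union>M" using matching_disjoint_part[OF mM'(1) M'(1)] .
  have mN: "matching H ?N"
    unfolding H_def matching_delete_verts[OF G]
    using matching_subset[OF mM'(1), of ?N] mM'(2) un by auto
  \<comment> \<open>The only edge in the component of \<open>u\<close> and \<open>v\<close> is
    \<open>uv\<close>, which \<open>M'\<close> may not use.\<close>
  have uncov: "t \<notin> \<Union>?N" if "t \<in> {u, v}" for t
  proof
    assume "t \<in> \<Union>?N"
    then obtain e where e: "e \<in> ?N" "t \<in> e" by blast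
    then have eH: "e \<in> edges H" using mN by (auto simp: matching_def)
    then have "e \<subseteq> reach H u" using edge_in_reach[OF H eH, of u] e that u(2) by blast
    then have "e \<in> edges (induced H (reach H u))" using eH by (simp add: induced_def)
    then have "e = {u, v}" using ind by (metis singletonD snd_conv)
    then show False using e mM'(3) by blast
  qed
  let ?K = "components H - {({u, v}, {{u, v}})}"
  have "\<exists>x. x \<in> verts C \<and> x \<notin> \<Union>?N" if "C \<in> ?K" for C
    using odd_component_uncovered[OF H mN, of C] odd[folded H_def, OF that] that by blast
  \<comment> \<open>\<open>f\<close> picks a missed vertex from each odd component. It is injective
    because a vertex determines its component.\<close>
  then obtain f where f: "\<And>C. C \<in> ?K \<Longrightarrow> f C \<in> verts C \<and> f C \<notin> \<Union>?N" by metis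
  have fC: "f C \<in> verts H \<and> C = induced H (reach H (f C))" if "C \<in> ?K" for C
    using component_eq[OF H, of C "f C"] f[OF that] that by blast
  have "inj_on f ?K" using fC by (metis inj_onI)
  then have "card (f ` ?K) = d" using count by (simp add: card_image H_def)
  moreover have "f ` ?K \<inter> {u, v} = {}"
  proof (rule ccontr)
    assume "\<not> ?thesis"
    then obtain C where C: "C \<in> ?K" "f C \<in> {u, v}" by blast
    then have "reach H (f C) = reach H u" using u(2) v(2) by blast
    then have "C = ({u, v}, {{u, v}})" using fC[OF C(1)] ind by metis
    then show False using C by blast
  qed
  ultimately have "card (f ` ?K \<union> {u, v}) = d + 2"
    using finite_components[OF H] \<open>u \<noteq> v\<close> by (subst card_Un_disjoint) auto
  moreover have "f ` ?K \<union> {u, v} \<subseteq> verts H - \<Union>?N" using f fC uncov u v by blast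
  then have "card (f ` ?K \<union> {u, v}) \<le> card (verts H - \<Union>?N)"
    using fin vH by (intro card_mono) auto
  moreover have "card (verts H - \<Union>?N) = d"
  proof -
    have NH: "\<Union>?N \<subseteq> verts H" using matching_Union_subset[OF H mN] .
    have "finite (verts H)" using H by (simp add: simple_graph_def)
    then have 1: "card (verts H - \<Union>?N) + card (\<Union>?N) = card (verts H)"
      using card_Diff_add[OF _ NH] by blast
    have sub: "\<Union>M \<subseteq> \<Union>M'" using M'(1) by blast
    have finM': "finite (\<Union>M')" using finite_matching[OF G mM'(1)] by simp
    have 2: "card (\<Union>?N) + card (\<Union>M) = card (\<Union>M')"
      unfolding un using card_Diff_add[OF finM' sub] .
    have 3: "card (verts H) + card S = card (verts G)"
      using card_Diff_add[OF fin S(1)] vH by simp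
    have 4: "card (verts G - ?T) + card ?T = card (verts G)"
      using card_Diff_add[OF fin cT(1)] .
    show ?thesis using 1 2 3 4 c' cT(2) S(2) cM(1) by linarith
  qed
  ultimately show False by simp
qed

theorem theorem4p1:
  fixes G :: "'a ugraph" and n k d :: nat and u v :: 'a
  assumes "simple_graph G"
    and "n \<ge> 2"
    and "nkd_graph n k d G"
    and "{u, v} \<in> edges G"
  shows "\<not> nkd_graph (n - 2) k d (delete_edge G {u, v}) \<longleftrightarrow>
    (\<exists>S. S \<subseteq> verts G \<and> card S = n - 2 + 2 * k \<and>
       (\<exists>M. k_matching k (induced G S) M) \<and>
       ({u, v}, {{u, v}}) \<in> components (delete_verts G S) \<and>
       card (components (delete_verts G S) - {({u, v}, {{u, v}})}) = d \<and>
       (\<forall>C \<in> components (delete_verts G S) - {({u, v}, {{u, v}})}.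
          odd (card (verts C)) \<and> factor_critical C))"
proof -
  have n: "nkd_graph (Suc (Suc (n - 2))) k d G"
  proof -
    have "Suc (Suc (n - 2)) = n" using assms(2) by simp
    then show ?thesis using assms(3) by (simp only:)
  qed
  show ?thesis
    using not_nkd_graph_delete_edge_imp[OF assms(1) n assms(4)]
      not_nkd_graph_delete_edge_if[OF assms(1,4)] by (intro iffI) blast+
qed

end
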